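(* Suppose that for each $\delta\in\mathcal K^*\setminus\{0\}$ there exists $x_\delta\in \mathcal S(A,\mathcal K,\mathcal B)$ with $\langle\delta,x_\delta\rangle>0$. Then, for any generating set $(G_L,G_C)$ of $C(A,\mathcal K,\mathcal B)$, $(G_L,G_C^+)$ generates the set $C_m(A,\mathcal K,\mathcal B)$ of $\mathcal K$-minimal inequalities, in the sense that every element of $G_L\cup G_C^+$ with nonzero first component is $\mathcal K$-minimal, and every $\mathcal K$-minimal inequality is a finite combination $\sum_{w\in G_L}\alpha_w w+\sum_{v\in G_C^+}\lambda_v v$ with $\alpha_w\in\mathbb R$ and $\lambda_v\ge 0$. In particular, all non-cone-implied extreme inequalities $(\mu;\eta_0)$ with $\mu\neq0$ (that is, all extreme inequalities with $\mu\ne 0$ that are not of the form $(\delta;0)$ with $\delta\in\mathcal K^*$) are $\mathcal K$-minimal. Thus, the $\mathcal K$-minimal inequalities along with the original conic constraint $x\in\mathcal K$ are sufficient to describe the closed convex hull of $\mathcal S(A,\mathcal K,\mathcal B)$: $$\overline{\mathrm{conv}}(\mathcal S(A,\mathcal K,\mathcal B))=\{x\in E:\ x\in\mathcal K,\ \langle\mu,x\rangle\ge\eta_0\ \ \forall(\mu;\eta_0)\in C_m(A,\mathcal K,\mathcal B)\}.$$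
   Context: Setting: $E$ is a finite-dimensional Euclidean space with inner product $\langle\cdot,\cdot\rangle$; $\mathcal K\subset E$ is a regular cone (closed, convex, pointed, full-dimensional); $\mathcal K^*=\{y\in E:\langle x,y\rangle\ge0\ \forall x\in\mathcal K\}$ is its dual cone; $A:E\to\mathbb R^m$ is linear; $\mathcal B\subseteq\mathbb R^m$ is an arbitrary nonempty set; $\mathcal S(A,\mathcal K,\mathcal B)=\{x\in\mathcal K: Ax\in\mathcal B\}$, assumed to satisfy $\mathcal S(A,\mathcal K,\mathcal B)\neq\emptyset$ and $\mathcal S(A,\mathcal K,\mathcal B)\ne\mathcal K$. A pair $(\mu;\eta_0)\in E\times\mathbb R$ is a valid inequality if $\langle\mu,x\rangle\ge\eta_0$ for all $x\in \mathcal S(A,\mathcal K,\mathcal B)$. $C(A,\mathcal K,\mathcal B)\subset E\times\mathbb R$ is the convex cone of all valid inequalities. A cone-implied inequality is one of the form $(\delta;0)$ with $\delta\in\mathcal K^*$. A valid inequality $(\mu;\eta_0)$ with $\mu\neq0$ is $\mathcal K$-minimal if every valid inequality $(\rho;\rho_0)$ with $\rho\ne\mu$ and $\mu-\rho\in\mathcal K^*$ satisfies $\rho_0<\eta_0$; $C_m(A,\mathcal K,\mathcal B)$ is the set of all $\mathcal K$-minimal inequalities. Let $L$ be the largest linear subspace contained in $C(A,\mathcal K,\mathcal B)$ and $C=C(A,\mathcal K,\mathcal B)\cap L^\perp$ (a pointed cone), so $C(A,\mathcal K,\mathcal B)=L+C$. A generating set $(G_L,G_C)$ of $C(A,\mathcal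 K,\mathcal B)$ is a minimal collection of elements with $G_L\subseteq L$, $G_C\subseteq C$ such that $C(A,\mathcal K,\mathcal B)=\{\sum_{w\in G_L}\alpha_w w+\sum_{v\in G_C}\lambda_v v:\ \alpha_w\in\mathbb R,\ \lambda_v\ge0\}$ (finite sums); generating sets are regarded as determined only up to $L$-multiples when $L$ is nontrivial. A valid inequality is extreme if there exists a generating set of $C(A,\mathcal K,\mathcal B)$ that includes it either in $G_L$ or in $G_C$. A vector $u$ is an $L$-multiple of $v$ if $u=\tau v+\ell$ for some $\tau>0$ and $\ell\in L$. $G_C^+$ denotes the set of vectors of $G_C$ that are not $L$-multiples of any cone-implied inequality $(\delta;0)$ with $\delta\in\mathcal K^*\setminus\{0\}$.
   Formalization: In the "in particular" clause, "not of the form (δ;0) with δ in K*" is read up to L-multiples: extreme inequalities that are L-multiples of some (δ;0), δ≠0, are excluded too, since the literal clause fails when L is nontrivial. *)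

theory Defs
  imports "HOL-Analysis.Analysis"
begin

definition regular_cone :: "'a::euclidean_space set \<Rightarrow> bool" where
  "regular_cone K \<longleftrightarrow>
     convex_cone K \<and> closed K \<and> K \<inter> uminus ` K = {0} \<and> aff_dim K = int DIM('a)"

definition dual_cone :: "'a::real_inner set \<Rightarrow> 'a set" where
  "dual_cone K = {y. \<forall>x\<in>K. 0 \<le> x \<bullet> y}"

definition feasible_set :: "('a \<Rightarrow> 'b) \<Rightarrow> 'a set \<Rightarrow> 'b set \<Rightarrow> 'a set" where
  "feasible_set A K B = {x \<in> K. A x \<in> B}"

definition valid_ineqs :: "('a::real_inner \<Rightarrow> 'b) \<Rightarrow> 'a set \<Rightarrow> 'b set \<Rightarrow> ('a \<times> real) set" where
  "valid_ineqs A K B = {(\<mu>, \<eta>\<^sub>0). \<forall>x\<in>feasible_set A K B. \<mu> \<bullet> x \<ge> \<eta>\<^sub>0}"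

definition cone_implied :: "'a::real_inner set \<Rightarrow> ('a \<times> real) set" where
  "cone_implied K = {(\<delta>, 0) | \<delta>. \<delta> \<in> dual_cone K}"

definition minimal_ineqs :: "('a::real_inner \<Rightarrow> 'b) \<Rightarrow> 'a set \<Rightarrow> 'b set \<Rightarrow> ('a \<times> real) set" where
  "minimal_ineqs A K B =
     {(\<mu>, \<eta>\<^sub>0). (\<mu>, \<eta>\<^sub>0) \<in> valid_ineqs A K B \<and> \<mu> \<noteq> 0 \<and>
        (\<forall>\<rho> \<rho>\<^sub>0. (\<rho>, \<rho>\<^sub>0) \<in> valid_ineqs A K B \<and> \<rho> \<noteq> \<mu> \<and> \<mu> - \<rho> \<in> dual_cone K \<longrightarrow> \<rho>\<^sub>0 < \<eta>\<^sub>0)}"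

definition lineality :: "'a::real_vector set \<Rightarrow> 'a set" where
  "lineality C = (GREATEST L. subspace L \<and> L \<subseteq> C)"

lemma lineality_eq:
  fixes C :: "'a::real_vector set"
  assumes "convex_cone C"
  shows "lineality C = C \<inter> uminus ` C"
proof -
  have add: "x + y \<in> C" if "x \<in> C" "y \<in> C" for x y
    using assms that by (rule convex_cone_add)
  have scale: "c *\<^sub>R x \<in> C" if "x \<in> C" "0 \<le> c" for x c
    using assms that by (simp add: convex_cone_scaleR)
  have mem: "x \<in> C \<inter> uminus ` C \<longleftrightarrow> x \<in> C \<and> - x \<in> C" for x
    by (force simp: image_iff)
  have "subspace (C \<inter> uminus ` C)"
    unfolding subspace_def
  proof (intro conjI ballI allI)
    show "0 \<in> C \<inter> uminus ` C"
      using assms by (simp add: mem convex_cone_iff)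
    show "x + y \<in> C \<inter> uminus ` C" if "x \<in> C \<inter> uminus ` C" "y \<in> C \<inter> uminus ` C" for x y
      using that add[of x y] add[of "- x" "- y"] unfolding mem by simp
    show "c *\<^sub>R x \<in> C \<inter> uminus ` C" if "x \<in> C \<inter> uminus ` C" for c x
      using that scale[of x c] scale[of "- x" c] scale[of x "- c"] scale[of "- x" "- c"]
      unfolding mem by (cases "0 \<le> c") auto
  qed
  moreover have "L \<subseteq> C \<inter> uminus ` C" if "subspace L" "L \<subseteq> C" for L
    using that mem subspace_neg by blast
  ultimately show ?thesis
    unfolding lineality_def by (intro Greatest_equality) auto
qed

lemma convex_cone_valid_ineqs: "convex_cone (valid_ineqs A K B)"
  by (auto simp: convex_cone_iff valid_ineqs_def zero_prod_def inner_left_distrib add_mono mult_left_mono)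

abbreviation ineq_lineality ::
  "('a::real_inner \<Rightarrow> 'b) \<Rightarrow> 'a set \<Rightarrow> 'b set \<Rightarrow> ('a \<times> real) set" where
  "ineq_lineality A K B \<equiv> lineality (valid_ineqs A K B)"

(* the elements sum_{w in GL} alpha_w w + sum_{v in GC} lambda_v v with lambda >= 0; both
   collections may be infinite, the sums are finite *)
definition generated_by :: "'a::real_vector set \<Rightarrow> 'a set \<Rightarrow> 'a set" where
  "generated_by GL GC =
     {(\<Sum>w\<in>F. \<alpha> w *\<^sub>R w) + (\<Sum>v\<in>H. l v *\<^sub>R v) | F H \<alpha> l.
        finite F \<and> F \<subseteq> GL \<and> finite H \<and> H \<subseteq> GC \<and> (\<forall>v\<in>H. 0 \<le> l v)}"

definition orthogonal_generating_set ::
  "('a::euclidean_space \<Rightarrow> 'b) \<Rightarrow> 'a set \<Rightarrow> 'b set \<Rightarrow> ('a \<times> real) set \<Rightarrow> ('a \<times> real) set \<Rightarrow> bool" where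
  "orthogonal_generating_set A K B GL GC \<longleftrightarrow>
     GL \<subseteq> ineq_lineality A K B \<and>
     GC \<subseteq> valid_ineqs A K B \<inter> (ineq_lineality A K B)\<^sup>\<bottom> \<and>
     generated_by GL GC = valid_ineqs A K B \<and>
     (\<forall>GL' GC'. GL' \<subseteq> GL \<and> GC' \<subseteq> GC \<and> generated_by GL' GC' = valid_ineqs A K B
        \<longrightarrow> GL' = GL \<and> GC' = GC)"

definition L_multiple :: "'a::real_vector set \<Rightarrow> 'a \<Rightarrow> 'a \<Rightarrow> bool" where
  "L_multiple L u v \<longleftrightarrow> (\<exists>\<tau>>0. \<exists>l\<in>L. u = \<tau> *\<^sub>R v + l)"

(* Generating sets are only determined up to L-multiples: starting from a minimal collection with
   GC0 contained in C = C(A,K,B) \<inter> L^\<bottom>, every v in GC0 may be replaced by one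
   of its L-multiples, which need not be orthogonal to L. *)
definition generating_set ::
  "('a::euclidean_space \<Rightarrow> 'b) \<Rightarrow> 'a set \<Rightarrow> 'b set \<Rightarrow> ('a \<times> real) set \<Rightarrow> ('a \<times> real) set \<Rightarrow> bool" where
  "generating_set A K B GL GC \<longleftrightarrow>
     (\<exists>GC0 f. orthogonal_generating_set A K B GL GC0 \<and> bij_betw f GC0 GC \<and>
        (\<forall>v\<in>GC0. L_multiple (ineq_lineality A K B) (f v) v))"

lemma orthogonal_generating_set_imp_generating_set:
  assumes "orthogonal_generating_set A K B GL GC"
  shows "generating_set A K B GL GC"
proof -
  have "0 \<in> ineq_lineality A K B"
    using convex_cone_valid_ineqs[of A K B]
    by (auto simp: lineality_eq convex_cone_iff image_iff intro: bexI[of _ 0])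
  then have "L_multiple (ineq_lineality A K B) v v" for v
    unfolding L_multiple_def by (intro exI[of _ 1] conjI bexI[of _ 0]) auto
  with assms show ?thesis
    unfolding generating_set_def by (intro exI[of _ GC] exI[of _ id]) auto
qed

definition extreme_ineq ::
  "('a::euclidean_space \<Rightarrow> 'b) \<Rightarrow> 'a set \<Rightarrow> 'b set \<Rightarrow> 'a \<times> real \<Rightarrow> bool" where
  "extreme_ineq A K B v \<longleftrightarrow> (\<exists>GL GC. generating_set A K B GL GC \<and> v \<in> GL \<union> GC)"

(* Being cone-implied has to be understood up to L-multiples as well. For K the nonnegative
   quadrant of the plane and the feasible set {x in K. x1 + x2 = 1}, the inequality
   (2/3, -1/3; -1/3) is extreme and not of the form (\<delta>; 0), but it is (1, 0; 0) minus one third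
   of (1, 1; 1), which belongs to L, and it is not K-minimal. *)
definition cone_implied_mod_L ::
  "('a::euclidean_space \<Rightarrow> 'b) \<Rightarrow> 'a set \<Rightarrow> 'b set \<Rightarrow> 'a \<times> real \<Rightarrow> bool" where
  "cone_implied_mod_L A K B v \<longleftrightarrow>
     (\<exists>\<delta>\<in>dual_cone K - {0}. L_multiple (ineq_lineality A K B) v (\<delta>, 0))"

lemma cone_implied_mod_L_trivial_lineality:
  assumes "ineq_lineality A K B = {0}" and "\<mu> \<noteq> 0"
  shows "cone_implied_mod_L A K B (\<mu>, \<eta>\<^sub>0) \<longleftrightarrow> (\<mu>, \<eta>\<^sub>0) \<in> cone_implied K"
proof
  assume "cone_implied_mod_L A K B (\<mu>, \<eta>\<^sub>0)"
  then obtain \<delta> \<tau> where "\<delta> \<in> dual_cone K" "\<tau> > 0" "\<mu> = \<tau> *\<^sub>R \<delta>" "\<eta>\<^sub>0 = 0"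
    using assms(1) by (auto simp: cone_implied_mod_L_def L_multiple_def)
  then show "(\<mu>, \<eta>\<^sub>0) \<in> cone_implied K"
    by (auto simp: cone_implied_def dual_cone_def)
next
  assume "(\<mu>, \<eta>\<^sub>0) \<in> cone_implied K"
  then show "cone_implied_mod_L A K B (\<mu>, \<eta>\<^sub>0)"
    using assms unfolding cone_implied_mod_L_def L_multiple_def cone_implied_def
    by (intro bexI[of _ \<mu>] exI[of _ 1]) auto
qed

definition non_cone_implied_part ::
  "('a::euclidean_space \<Rightarrow> 'b) \<Rightarrow> 'a set \<Rightarrow> 'b set \<Rightarrow> ('a \<times> real) set \<Rightarrow> ('a \<times> real) set" where
  "non_cone_implied_part A K B GC = {v \<in> GC. \<not> cone_implied_mod_L A K B v}"

end

theory Submission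
  imports Defs
begin

text \<open>
  Write \<open>S\<close> for the feasible set, \<open>V\<close> for the cone of valid inequalities, \<open>L\<close> for its lineality
  space and \<open>K\<^sup>*\<close> for the dual cone. Since the right-hand side of a valid inequality may always be
  lowered, \<open>v \<in> V\<close> with nonzero first component fails to be minimal exactly when it splits inside \<open>V\<close>
  as \<open>v = u + (\<delta>, 0)\<close> with \<open>\<delta> \<in> K\<^sup>* - {0}\<close> (lemma \<open>minimal_ineqs_iff\<close>). The hypothesis on the
  feasible set says that no such \<open>(\<delta>, 0)\<close> lies in \<open>L\<close>.

  \<^item> An element of \<open>L\<close> cannot split off \<open>(\<delta>, 0)\<close>, because the summands of an element of \<open>L\<close> lie in
    \<open>L\<close> again. A generator in \<open>G\<^sub>C\<close> spans an extreme ray of \<open>V\<close> modulo \<open>L\<close>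
    (lemma \<open>irredundant_generator_is_extreme\<close>), so if it splits off \<open>(\<delta>, 0)\<close>, then it is an
    \<open>L\<close>-multiple of \<open>(\<delta>, 0)\<close>. Hence the generators in \<open>G\<^sub>L \<union> G\<^sub>C\<^sup>+\<close> with nonzero first
    component are minimal.
  \<^item> Conversely, expand a minimal inequality in the generators. The generators outside \<open>G\<^sub>C\<^sup>+\<close>
    together contribute \<open>(\<delta>, 0)\<close> with \<open>\<delta> \<in> K\<^sup>*\<close>, up to an element of \<open>L\<close>. This \<open>\<delta>\<close> vanishes by
    minimality, and \<open>L\<close> is spanned by \<open>G\<^sub>L\<close>.
  \<^item> For the description of the closed convex hull, a point outside it violates a valid inequality
    \<open>(\<mu>, \<eta>)\<close>. A point \<open>z\<close> in the relative interior of the convex hull of \<open>S\<close> satisfies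
    \<open>\<delta> \<bullet> z > 0\<close> for all \<open>\<delta> \<in> K\<^sup>* - {0}\<close>, so the set of \<open>\<delta> \<in> K\<^sup>*\<close> for which
    \<open>(\<mu> - \<delta>, \<eta>)\<close> is valid is compact, and a maximiser of \<open>\<delta> \<bullet> z\<close> on it gives an inequality from
    which nothing more can be split off. On \<open>K\<close> the new inequality is at least as strong as the old
    one, and it is violated by the same point (lemma \<open>ex_minimal_ineq_dominating\<close>).
\<close>

section \<open>Lineality spaces and generators of convex cones\<close>

lemma in_lineality_iff:
  assumes "convex_cone C"
  shows "x \<in> lineality C \<longleftrightarrow> x \<in> C \<and> - x \<in> C"
  by (force simp: lineality_eq[OF assms] image_iff)

lemma subspace_lineality:
  assumes "convex_cone C"
  shows "subspace (lineality C)"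
proof -
  have "c *\<^sub>R x \<in> lineality C" if "x \<in> lineality C" for c x
  proof -
    from that have *: "x \<in> C" "- x \<in> C"
      using assms by (auto simp: in_lineality_iff)
    have "\<bar>c\<bar> *\<^sub>R x \<in> C" "\<bar>c\<bar> *\<^sub>R (- x) \<in> C"
      using *[THEN convex_cone_scaleR[OF assms abs_ge_zero]] by blast+
    then show ?thesis
      unfolding in_lineality_iff[OF assms] by (cases "c \<ge> 0") auto
  qed
  moreover have "x + y \<in> lineality C" if "x \<in> lineality C" "y \<in> lineality C" for x y
    using that convex_cone_add[OF assms, of x y] convex_cone_add[OF assms, of "- x" "- y"]
    by (simp add: in_lineality_iff[OF assms])
  ultimately show ?thesis
    using convex_cone_contains_0[OF assms]
    by (simp add: subspace_def in_lineality_iff[OF assms])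
qed

text \<open>The lineality space is a face of the cone.\<close>

lemma add_in_lineality_imp_left:
  assumes C: "convex_cone C" and "a \<in> C" "b \<in> C" "a + b \<in> lineality C"
  shows "a \<in> lineality C"
proof -
  have "- (a + b) + b \<in> C"
    using assms by (intro convex_cone_add[OF C]) (auto simp: in_lineality_iff[OF C])
  then show ?thesis
    using assms by (simp add: in_lineality_iff[OF C])
qed

lemma add_lineality_imp_in_cone:
  assumes "convex_cone C" "a \<in> C" "l \<in> lineality C"
  shows "a + l \<in> C"
  using assms convex_cone_add in_lineality_iff by blast

lemma convex_cone_hull_explicit:
  "convex_cone hull G = {\<Sum>v\<in>H. l v *\<^sub>R v | H l. finite H \<and> H \<subseteq> G \<and> (\<forall>v\<in>H. 0 \<le> l v)}"
    (is "_ = ?R")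
proof (rule hull_unique)
  show "G \<subseteq> ?R"
  proof
    fix v assume "v \<in> G"
    then have "v = (\<Sum>v\<in>{v}. 1 *\<^sub>R v) \<and> finite {v} \<and> {v} \<subseteq> G \<and> (\<forall>v\<in>{v}. (0::real) \<le> 1)"
      by simp
    then show "v \<in> ?R"
      by (intro CollectI exI[of _ "{v}"] exI[of _ "\<lambda>_. 1"])
  qed
next
  have add: "x + y \<in> ?R" if "x \<in> ?R" "y \<in> ?R" for x y
  proof -
    from that obtain H l H' l' where
      H: "x = (\<Sum>v\<in>H. l v *\<^sub>R v)" "finite H" "H \<subseteq> G" "\<forall>v\<in>H. 0 \<le> l v" and
      H': "y = (\<Sum>v\<in>H'. l' v *\<^sub>R v)" "finite H'" "H' \<subseteq> G" "\<forall>v\<in>H'. 0 \<le> l' v"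
      by auto
    \<comment> \<open>Extend both coefficient families by zero to the common index set.\<close>
    define k where "k v = (if v \<in> H then l v else 0) + (if v \<in> H' then l' v else 0)" for v
    have "x = (\<Sum>v\<in>H \<union> H'. (if v \<in> H then l v else 0) *\<^sub>R v)"
      unfolding H(1) using H(2) H'(2) by (intro sum.mono_neutral_cong_left) auto
    moreover have "y = (\<Sum>v\<in>H \<union> H'. (if v \<in> H' then l' v else 0) *\<^sub>R v)"
      unfolding H'(1) using H(2) H'(2) by (intro sum.mono_neutral_cong_left) auto
    ultimately have "x + y = (\<Sum>v\<in>H \<union> H'. k v *\<^sub>R v)"
      by (simp add: k_def sum.distrib scaleR_left_distrib)
    moreover have "\<forall>v\<in>H \<union> H'. 0 \<le> k v"
      using H(4) H'(4) by (auto simp: k_def)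
    ultimately show ?thesis
      using H H' by (intro CollectI exI[of _ "H \<union> H'"] exI[of _ k]) auto
  qed
  have scale: "c *\<^sub>R x \<in> ?R" if "x \<in> ?R" "0 \<le> c" for x c
  proof -
    from that obtain H l where
      "x = (\<Sum>v\<in>H. l v *\<^sub>R v)" "finite H" "H \<subseteq> G" "\<forall>v\<in>H. 0 \<le> l v"
      by auto
    with \<open>0 \<le> c\<close> show ?thesis
      by (intro CollectI exI[of _ H] exI[of _ "\<lambda>v. c * l v"]) (auto simp: scaleR_sum_right)
  qed
  have "0 \<in> ?R"
    by (intro CollectI exI[of _ "{}"]) auto
  then show "convex_cone ?R"
    unfolding convex_cone_iff by (intro conjI ballI allI impI add scale)
next
  fix T assume T: "G \<subseteq> T" "convex_cone T"
  have "(\<Sum>v\<in>H. l v *\<^sub>R v) \<in> T" if "finite H" "H \<subseteq> G" "\<forall>v\<in>H. 0 \<le> l v" for H l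
    using that
  proof (induction H rule: finite_induct)
    case empty
    then show ?case using T(2) by (simp add: convex_cone_contains_0)
  next
    case (insert v H)
    then show ?case using T by (auto intro!: convex_cone_add convex_cone_scaleR)
  qed
  then show "?R \<subseteq> T" by auto
qed

text \<open>
  This form replaces explicit linear combinations by hulls, which can be handled through closure
  properties.
\<close>

lemma generated_by_eq_span_plus_hull:
  "generated_by GL GC = {a + b | a b. a \<in> span GL \<and> b \<in> convex_cone hull GC}"
proof (intro equalityI subsetI)
  fix x assume "x \<in> generated_by GL GC"
  then obtain F H \<alpha> l where
    "finite F" "F \<subseteq> GL" "finite H" "H \<subseteq> GC" "\<forall>v\<in>H. 0 \<le> l v"
    "x = (\<Sum>w\<in>F. \<alpha> w *\<^sub>R w) + (\<Sum>v\<in>H. l v *\<^sub>R v)"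
    unfolding generated_by_def by auto
  moreover from this have "(\<Sum>w\<in>F. \<alpha> w *\<^sub>R w) \<in> span GL"
    by (meson span_sum span_scale span_base subsetD)
  moreover from calculation have "(\<Sum>v\<in>H. l v *\<^sub>R v) \<in> convex_cone hull GC"
    unfolding convex_cone_hull_explicit by blast
  ultimately show "x \<in> {a + b | a b. a \<in> span GL \<and> b \<in> convex_cone hull GC}"
    by blast
next
  fix x assume "x \<in> {a + b | a b. a \<in> span GL \<and> b \<in> convex_cone hull GC}"
  then obtain a b where x: "x = a + b" "a \<in> span GL" "b \<in> convex_cone hull GC"
    by blast
  from x(2) obtain F \<alpha> where F: "finite F" "F \<subseteq> GL" "a = (\<Sum>w\<in>F. \<alpha> w *\<^sub>R w)"
    unfolding span_explicit by auto
  from x(3) obtain H l where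
    H: "finite H" "H \<subseteq> GC" "\<forall>v\<in>H. 0 \<le> l v" "b = (\<Sum>v\<in>H. l v *\<^sub>R v)"
    unfolding convex_cone_hull_explicit by auto
  show "x \<in> generated_by GL GC"
    unfolding generated_by_def x(1) F(3) H(4) using F(1,2) H(1,2,3) by auto
qed

lemma span_plus_hull_in_generated_by:
  "a \<in> span GL \<Longrightarrow> b \<in> convex_cone hull GC \<Longrightarrow> a + b \<in> generated_by GL GC"
  unfolding generated_by_eq_span_plus_hull by blast

lemma generated_byE:
  assumes "x \<in> generated_by GL GC"
  obtains a b where "x = a + b" "a \<in> span GL" "b \<in> convex_cone hull GC"
  using assms unfolding generated_by_eq_span_plus_hull by blast

lemma convex_cone_generated_by: "convex_cone (generated_by GL GC)"
proof -
  have "generated_by GL GC = (\<Union>a\<in>span GL. \<Union>b\<in>convex_cone hull GC. {a + b})"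
    unfolding generated_by_eq_span_plus_hull by blast
  then show ?thesis
    by (simp add: convex_cone_sums convex_cone_span convex_cone_convex_cone_hull)
qed

lemma generators_in_generated_by:
  "span GL \<subseteq> generated_by GL GC" "convex_cone hull GC \<subseteq> generated_by GL GC"
  using span_plus_hull_in_generated_by[of _ GL 0 GC] span_plus_hull_in_generated_by[of 0 GL _ GC]
  by (auto simp: convex_cone_hull_contains_0 span_zero)

lemma generated_by_minimal:
  assumes "span GL \<subseteq> C" "GC \<subseteq> C" "convex_cone C"
  shows "generated_by GL GC \<subseteq> C"
proof
  fix x assume "x \<in> generated_by GL GC"
  then obtain a b where "x = a + b" "a \<in> span GL" "b \<in> convex_cone hull GC"
    by (rule generated_byE)
  then show "x \<in> C"
    using assms hull_minimal[of GC C convex_cone] convex_cone_add[of C a b] by auto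
qed

lemma convex_cone_hull_split_generator:
  assumes "b \<in> convex_cone hull G" "v \<in> G"
  obtains \<alpha> r where "0 \<le> \<alpha>" "r \<in> convex_cone hull (G - {v})" "b = \<alpha> *\<^sub>R v + r"
proof -
  have "b \<in> convex_cone hull ({v} \<union> (G - {v}))"
    using assms by (simp add: insert_absorb)
  then obtain p r where "p \<in> convex_cone hull {v}" "r \<in> convex_cone hull (G - {v})" "b = p + r"
    unfolding convex_cone_hull_Un by blast
  moreover have "convex_cone hull {v} \<subseteq> {\<alpha> *\<^sub>R v | \<alpha>. 0 \<le> \<alpha>}"
  proof (rule hull_minimal)
    have "v = 1 *\<^sub>R v \<and> 0 \<le> (1::real)"
      by simp
    then show "{v} \<subseteq> {\<alpha> *\<^sub>R v | \<alpha>. 0 \<le> \<alpha>}"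
      by blast
    have "{\<alpha> *\<^sub>R v | \<alpha>. 0 \<le> \<alpha>} = (\<lambda>\<alpha>. \<alpha> *\<^sub>R v) ` {0..}"
      by auto
    moreover have "convex_cone {0::real..}"
      by (simp add: convex_cone_iff)
    ultimately show "convex_cone {\<alpha> *\<^sub>R v | \<alpha>. 0 \<le> \<alpha>}"
      by (simp add: convex_cone_linear_image)
  qed
  ultimately show ?thesis
    using that by blast
qed

lemma span_lineality_generators:
  fixes C :: "'a::real_inner set"
  assumes C: "convex_cone C"
    and GL: "GL \<subseteq> lineality C" and GC: "GC \<subseteq> (lineality C)\<^sup>\<bottom>"
    and gen: "generated_by GL GC = C"
  shows "span GL = lineality C"
proof
  show *: "span GL \<subseteq> lineality C"
    using GL subspace_lineality[OF C] by (rule span_minimal)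
  show "lineality C \<subseteq> span GL"
  proof
    fix l assume l: "l \<in> lineality C"
    then have "l \<in> generated_by GL GC"
      unfolding gen in_lineality_iff[OF C] by blast
    then obtain a b where ab: "l = a + b" "a \<in> span GL" "b \<in> convex_cone hull GC"
      by (rule generated_byE)
    have "b \<in> (lineality C)\<^sup>\<bottom>"
      using ab(3) hull_minimal[of GC _ convex_cone, OF GC]
        subspace_imp_convex_cone[OF subspace_orthogonal_comp] by blast
    moreover have "b \<in> lineality C"
      using subspace_diff[OF subspace_lineality[OF C] l, of a] ab * by auto
    ultimately have "b = 0"
      by (auto simp: orthogonal_comp_def orthogonal_def)
    with ab show "l \<in> span GL" by simp
  qed
qed

text \<open>
  Suppose \<open>v = a + b\<close> modulo the lineality space, expand \<open>a\<close> and \<open>b\<close> in the generators and compare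
  the coefficients of \<open>v\<close>. If those on the right add up to less than one, then \<open>v\<close> can be solved for
  and is redundant. Otherwise the contributions of the other generators to \<open>a\<close> and \<open>b\<close> add up to an
  element of \<open>- C\<close> modulo lineality, hence each of them lies in the lineality space.
\<close>

lemma irredundant_generator_is_extreme:
  fixes C :: "'a::real_vector set"
  assumes C: "convex_cone C" and L: "span GL = lineality C"
    and gen: "generated_by GL GC = C"
    and v: "v \<in> GC" "v \<notin> generated_by GL (GC - {v})"
    and ab: "a \<in> C" "b \<in> C" "v - (a + b) \<in> lineality C"
  obtains \<beta> where "0 \<le> \<beta>" "b - \<beta> *\<^sub>R v \<in> lineality C"
proof -
  note SL = subspace_lineality[OF C]
  have expand: "\<exists>l \<alpha> r. l \<in> lineality C \<and> 0 \<le> \<alpha> \<and> r \<in> convex_cone hull (GC - {v}) \<and>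
      c = l + (\<alpha> *\<^sub>R v + r)" if c: "c \<in> C" for c
  proof -
    from c obtain l d where ld: "c = l + d" "l \<in> span GL" "d \<in> convex_cone hull GC"
      unfolding gen[symmetric] by (rule generated_byE)
    from ld(3) v(1) obtain \<alpha> r where
      "0 \<le> \<alpha>" "r \<in> convex_cone hull (GC - {v})" "d = \<alpha> *\<^sub>R v + r"
      by (rule convex_cone_hull_split_generator)
    with ld L show ?thesis by blast
  qed
  obtain l\<^sub>a \<alpha> r\<^sub>a where a: "l\<^sub>a \<in> lineality C" "0 \<le> \<alpha>" "r\<^sub>a \<in> convex_cone hull (GC - {v})"
      "a = l\<^sub>a + (\<alpha> *\<^sub>R v + r\<^sub>a)"
    using expand[OF ab(1)] by blast
  obtain l\<^sub>b \<beta> r\<^sub>b where b: "l\<^sub>b \<in> lineality C" "0 \<le> \<beta>" "r\<^sub>b \<in> convex_cone hull (GC - {v})"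
      "b = l\<^sub>b + (\<beta> *\<^sub>R v + r\<^sub>b)"
    using expand[OF ab(2)] by blast
  define l where "l = v - (a + b) + (l\<^sub>a + l\<^sub>b)"
  have l: "l \<in> lineality C"
    unfolding l_def using a(1) b(1) ab(3) by (intro subspace_add[OF SL])
  have v_eq: "(1 - (\<alpha> + \<beta>)) *\<^sub>R v = l + (r\<^sub>a + r\<^sub>b)"
    unfolding l_def a(4) b(4) by (simp add: algebra_simps)
  have r: "r\<^sub>a + r\<^sub>b \<in> convex_cone hull (GC - {v})"
    using a(3) b(3) by (rule convex_cone_hull_add)
  have sub: "convex_cone hull (GC - {v}) \<subseteq> C"
    using generators_in_generated_by(2)[of GC GL] hull_mono[of "GC - {v}" GC convex_cone]
    unfolding gen by blast
  have "\<alpha> + \<beta> \<ge> 1"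
  proof (rule ccontr)
    assume *: "\<not> \<alpha> + \<beta> \<ge> 1"
    have "l + (r\<^sub>a + r\<^sub>b) \<in> generated_by GL (GC - {v})"
      using l r L by (intro span_plus_hull_in_generated_by) auto
    then have "(1 / (1 - (\<alpha> + \<beta>))) *\<^sub>R (l + (r\<^sub>a + r\<^sub>b)) \<in> generated_by GL (GC - {v})"
      using * by (intro convex_cone_scaleR[OF convex_cone_generated_by]) auto
    then show False
      using * v(2) unfolding v_eq[symmetric] by simp
  qed
  moreover have "v \<in> C"
    using generators_in_generated_by(2)[of GC GL] hull_inc[OF v(1), of convex_cone] gen by blast
  ultimately have "(\<alpha> + \<beta> - 1) *\<^sub>R v + r\<^sub>a \<in> C"
    using a(3) sub by (auto intro!: convex_cone_add[OF C] convex_cone_scaleR[OF C])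
  moreover have "r\<^sub>b + ((\<alpha> + \<beta> - 1) *\<^sub>R v + r\<^sub>a) = - l"
    using v_eq by (simp add: algebra_simps)
  ultimately have "r\<^sub>b \<in> lineality C"
    using add_in_lineality_imp_left[OF C, of r\<^sub>b] b(3) sub subspace_neg[OF SL l] by auto
  then have "b - \<beta> *\<^sub>R v \<in> lineality C"
    unfolding b(4) using subspace_add[OF SL b(1), of r\<^sub>b] by simp
  with b(2) show ?thesis by (rule that)
qed

section \<open>Generating sets of the cone of valid inequalities\<close>

lemma in_ineq_lineality_iff:
  "(\<mu>, \<eta>) \<in> ineq_lineality A K B \<longleftrightarrow> (\<forall>x\<in>feasible_set A K B. \<mu> \<bullet> x = \<eta>)"
  unfolding in_lineality_iff[OF convex_cone_valid_ineqs] by (force simp: valid_ineqs_def)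

lemma orthogonal_generating_set_irredundant:
  assumes "orthogonal_generating_set A K B GL GC" "v \<in> GC"
  shows "v \<notin> generated_by GL (GC - {v})"
proof
  assume v: "v \<in> generated_by GL (GC - {v})"
  have "GC \<subseteq> generated_by GL (GC - {v})"
    using v generators_in_generated_by(2)[of "GC - {v}" GL] hull_subset[of "GC - {v}" convex_cone]
    by blast
  then have "generated_by GL GC \<subseteq> generated_by GL (GC - {v})"
    by (intro generated_by_minimal generators_in_generated_by(1) convex_cone_generated_by)
  moreover have "generated_by GL (GC - {v}) \<subseteq> generated_by GL GC"
    using generators_in_generated_by[of GL GC] generators_in_generated_by(2)[of GC GL]
      hull_subset[of GC convex_cone]
    by (intro generated_by_minimal convex_cone_generated_by) auto
  ultimately have "generated_by GL (GC - {v}) = valid_ineqs A K B"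
    using assms(1) unfolding orthogonal_generating_set_def by blast
  then have "GC - {v} = GC"
    using assms(1) unfolding orthogonal_generating_set_def by blast
  with assms(2) show False by blast
qed

lemma generating_set_span_lineality:
  assumes "generating_set A K B GL GC"
  shows "span GL = ineq_lineality A K B"
  using assms span_lineality_generators[OF convex_cone_valid_ineqs]
  unfolding generating_set_def orthogonal_generating_set_def by (metis le_inf_iff)

lemma generating_set_generates:
  assumes "generating_set A K B GL GC"
  shows "generated_by GL GC = valid_ineqs A K B"
proof -
  note L = generating_set_span_lineality[OF assms]
  note SL = subspace_lineality[OF convex_cone_valid_ineqs, of A K B]
  from assms obtain GC\<^sub>0 f where f: "orthogonal_generating_set A K B GL GC\<^sub>0" "bij_betw f GC\<^sub>0 GC"
      "\<And>v. v \<in> GC\<^sub>0 \<Longrightarrow> L_multiple (ineq_lineality A K B) (f v) v"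
    unfolding generating_set_def by blast
  have GC\<^sub>0: "GC\<^sub>0 \<subseteq> valid_ineqs A K B" "generated_by GL GC\<^sub>0 = valid_ineqs A K B"
    using f(1) unfolding orthogonal_generating_set_def by auto
  show ?thesis
  proof
    have "f v \<in> valid_ineqs A K B" if v: "v \<in> GC\<^sub>0" for v
    proof -
      from f(3)[OF v] obtain \<tau> l where "\<tau> > 0" "l \<in> ineq_lineality A K B" "f v = \<tau> *\<^sub>R v + l"
        unfolding L_multiple_def by blast
      with v GC\<^sub>0(1) show ?thesis
        by (auto intro!: add_lineality_imp_in_cone convex_cone_scaleR convex_cone_valid_ineqs)
    qed
    then have "GC \<subseteq> valid_ineqs A K B"
      using f(2) by (auto simp: bij_betw_def)
    moreover have "span GL \<subseteq> valid_ineqs A K B"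
      unfolding L by (auto simp: in_lineality_iff[OF convex_cone_valid_ineqs])
    ultimately show "generated_by GL GC \<subseteq> valid_ineqs A K B"
      by (intro generated_by_minimal convex_cone_valid_ineqs)
  next
    have "v \<in> generated_by GL GC" if v: "v \<in> GC\<^sub>0" for v
    proof -
      from f(3)[OF v] obtain \<tau> l where \<tau>: "\<tau> > 0" "l \<in> ineq_lineality A K B" "f v = \<tau> *\<^sub>R v + l"
        unfolding L_multiple_def by blast
      have "f v \<in> convex_cone hull GC"
        using v f(2) by (intro hull_inc) (auto simp: bij_betw_def)
      moreover have "- l \<in> span GL"
        unfolding L using SL \<tau>(2) by (rule subspace_neg)
      ultimately have "(1 / \<tau>) *\<^sub>R (- l + f v) \<in> generated_by GL GC"
        using \<tau>(1)
        by (intro convex_cone_scaleR[OF convex_cone_generated_by] span_plus_hull_in_generated_by)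
          auto
      then show ?thesis
        using \<tau>(1,3) by simp
    qed
    then show "valid_ineqs A K B \<subseteq> generated_by GL GC"
      unfolding GC\<^sub>0(2)[symmetric]
      by (intro generated_by_minimal generators_in_generated_by(1) convex_cone_generated_by) auto
  qed
qed

lemma generating_set_subset_valid:
  assumes "generating_set A K B GL GC"
  shows "GC \<subseteq> valid_ineqs A K B"
  using generators_in_generated_by(2)[of GC GL] hull_subset[of GC convex_cone]
  unfolding generating_set_generates[OF assms] by blast

text \<open>Extremality modulo \<open>L\<close> is inherited by \<open>L\<close>-multiples of irredundant generators.\<close>

lemma generating_set_extreme:
  assumes gs: "generating_set A K B GL GC" and "a + b \<in> GC"
    and ab: "a \<in> valid_ineqs A K B" "b \<in> valid_ineqs A K B"
  obtains \<beta> where "0 \<le> \<beta>" "b - \<beta> *\<^sub>R (a + b) \<in> ineq_lineality A K B"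
proof -
  let ?L = "ineq_lineality A K B"
  note SL = subspace_lineality[OF convex_cone_valid_ineqs, of A K B]
  from gs obtain GC\<^sub>0 f where f: "orthogonal_generating_set A K B GL GC\<^sub>0" "bij_betw f GC\<^sub>0 GC"
      "\<And>v. v \<in> GC\<^sub>0 \<Longrightarrow> L_multiple ?L (f v) v"
    unfolding generating_set_def by blast
  have "a + b \<in> f ` GC\<^sub>0"
    using \<open>a + b \<in> GC\<close> f(2) by (simp add: bij_betw_def)
  then obtain v where v: "v \<in> GC\<^sub>0" "a + b = f v"
    by blast
  with f(3) obtain \<tau> l where \<tau>: "\<tau> > 0" "l \<in> ?L" "a + b = \<tau> *\<^sub>R v + l"
    unfolding L_multiple_def by metis
  define s where "s = 1 / \<tau>"
  have s: "s > 0" "s * \<tau> = 1" "s \<noteq> 0"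
    using \<tau>(1) by (auto simp: s_def)
  have "s *\<^sub>R a + s *\<^sub>R b = v + s *\<^sub>R l"
    using s(2) arg_cong[OF \<tau>(3), of "scaleR s"] by (simp add: scaleR_right_distrib)
  then have "v - (s *\<^sub>R a + s *\<^sub>R b) = - (s *\<^sub>R l)"
    by simp
  then have split: "v - (s *\<^sub>R a + s *\<^sub>R b) \<in> ?L"
    using subspace_neg[OF SL subspace_scale[OF SL \<tau>(2), of s]] by simp
  have gen: "generated_by GL GC\<^sub>0 = valid_ineqs A K B"
    using f(1) unfolding orthogonal_generating_set_def by blast
  obtain \<gamma> where \<gamma>: "0 \<le> \<gamma>" "s *\<^sub>R b - \<gamma> *\<^sub>R v \<in> ?L"
  proof (rule irredundant_generator_is_extreme[OF convex_cone_valid_ineqs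
        generating_set_span_lineality[OF gs] gen v(1)
        orthogonal_generating_set_irredundant[OF f(1) v(1)] _ _ split])
    show "s *\<^sub>R a \<in> valid_ineqs A K B" "s *\<^sub>R b \<in> valid_ineqs A K B"
      using ab s(1) by (auto intro!: convex_cone_scaleR convex_cone_valid_ineqs)
  qed
  have "\<tau> *\<^sub>R (s *\<^sub>R b - \<gamma> *\<^sub>R v) - \<gamma> *\<^sub>R l \<in> ?L"
    by (rule subspace_diff[OF SL subspace_scale[OF SL \<gamma>(2)] subspace_scale[OF SL \<tau>(2)]])
  also have "\<tau> *\<^sub>R (s *\<^sub>R b - \<gamma> *\<^sub>R v) - \<gamma> *\<^sub>R l = b - \<gamma> *\<^sub>R (a + b)"
    unfolding \<tau>(3) using s(2) by (simp add: algebra_simps)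
  finally show ?thesis
    using \<gamma>(1) that by blast
qed

section \<open>Minimal inequalities\<close>

lemma convex_cone_dual_cone: "convex_cone (dual_cone K)"
  by (auto simp: convex_cone_iff dual_cone_def inner_right_distrib)

lemma dual_cone_inner_nonneg: "\<delta> \<in> dual_cone K \<Longrightarrow> x \<in> K \<Longrightarrow> 0 \<le> \<delta> \<bullet> x"
  by (metis (mono_tags) dual_cone_def inner_commute mem_Collect_eq)

lemma cone_implied_valid:
  assumes "\<delta> \<in> dual_cone K"
  shows "(\<delta>, 0) \<in> valid_ineqs A K B"
  using dual_cone_inner_nonneg[OF assms] by (auto simp: valid_ineqs_def feasible_set_def)

text \<open>
  A valid inequality \<open>(\<rho>, \<rho>\<^sub>0)\<close> that refutes minimality of \<open>(\<mu>, \<eta>)\<close> may be taken with \<open>\<rho>\<^sub>0 = \<eta>\<close>,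
  since lowering the right-hand side keeps it valid.
\<close>

lemma minimal_ineqs_iff:
  "v \<in> minimal_ineqs A K B \<longleftrightarrow> v \<in> valid_ineqs A K B \<and> fst v \<noteq> 0 \<and>
     (\<forall>\<delta>\<in>dual_cone K. v - (\<delta>, 0) \<in> valid_ineqs A K B \<longrightarrow> \<delta> = 0)"
proof -
  obtain \<mu> \<eta> where v: "v = (\<mu>, \<eta>)"
    by (cases v)
  have "(\<forall>\<rho> \<rho>\<^sub>0. (\<rho>, \<rho>\<^sub>0) \<in> valid_ineqs A K B \<and> \<rho> \<noteq> \<mu> \<and> \<mu> - \<rho> \<in> dual_cone K \<longrightarrow> \<rho>\<^sub>0 < \<eta>) \<longleftrightarrow>
    (\<forall>\<delta>\<in>dual_cone K. (\<mu> - \<delta>, \<eta>) \<in> valid_ineqs A K B \<longrightarrow> \<delta> = 0)" (is "?l \<longleftrightarrow> ?r")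
  proof
    assume l: ?l
    show ?r
    proof (intro ballI impI)
      fix \<delta> assume "\<delta> \<in> dual_cone K" "(\<mu> - \<delta>, \<eta>) \<in> valid_ineqs A K B"
      then show "\<delta> = 0"
        using l[rule_format, of "\<mu> - \<delta>" \<eta>] by auto
    qed
  next
    assume r: ?r
    show ?l
    proof (intro allI impI, rule ccontr)
      fix \<rho> \<rho>\<^sub>0
      assume *: "(\<rho>, \<rho>\<^sub>0) \<in> valid_ineqs A K B \<and> \<rho> \<noteq> \<mu> \<and> \<mu> - \<rho> \<in> dual_cone K" "\<not> \<rho>\<^sub>0 < \<eta>"
      then have "(\<rho>, \<eta>) \<in> valid_ineqs A K B"
        by (force simp: valid_ineqs_def)
      then show False
        using r[rule_format, of "\<mu> - \<rho>"] * by auto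
    qed
  qed
  then show ?thesis
    by (simp add: v minimal_ineqs_def)
qed

lemma lineality_ineq_minimal:
  assumes sep: "\<forall>\<delta>\<in>dual_cone K - {0}. \<exists>x\<in>feasible_set A K B. \<delta> \<bullet> x > 0"
    and v: "v \<in> ineq_lineality A K B" "fst v \<noteq> 0"
  shows "v \<in> minimal_ineqs A K B"
  unfolding minimal_ineqs_iff
proof (intro conjI ballI impI)
  show "v \<in> valid_ineqs A K B"
    using v(1) by (simp add: in_lineality_iff[OF convex_cone_valid_ineqs])
  fix \<delta> assume \<delta>: "\<delta> \<in> dual_cone K" "v - (\<delta>, 0) \<in> valid_ineqs A K B"
  have "(\<delta>, 0) \<in> ineq_lineality A K B"
    using add_in_lineality_imp_left[OF convex_cone_valid_ineqs cone_implied_valid[OF \<delta>(1)] \<delta>(2)] v(1)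
    by simp
  then show "\<delta> = 0"
    using sep \<delta>(1) by (force simp: in_ineq_lineality_iff)
qed (fact v(2))

lemma non_cone_implied_generator_minimal:
  assumes sep: "\<forall>\<delta>\<in>dual_cone K - {0}. \<exists>x\<in>feasible_set A K B. \<delta> \<bullet> x > 0"
    and gs: "generating_set A K B GL GC"
    and v: "v \<in> non_cone_implied_part A K B GC" "fst v \<noteq> 0"
  shows "v \<in> minimal_ineqs A K B"
  unfolding minimal_ineqs_iff
proof (intro conjI ballI impI)
  note SL = subspace_lineality[OF convex_cone_valid_ineqs, of A K B]
  have vGC: "v \<in> GC" "\<not> cone_implied_mod_L A K B v"
    using v(1) by (auto simp: non_cone_implied_part_def)
  then show "v \<in> valid_ineqs A K B"
    using generating_set_subset_valid[OF gs] by blast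
  fix \<delta> assume \<delta>: "\<delta> \<in> dual_cone K" "v - (\<delta>, 0) \<in> valid_ineqs A K B"
  obtain \<beta> where \<beta>: "0 \<le> \<beta>" "(\<delta>, 0) - \<beta> *\<^sub>R v \<in> ineq_lineality A K B"
    using generating_set_extreme[OF gs _ \<delta>(2) cone_implied_valid[OF \<delta>(1)]] vGC(1) by auto
  show "\<delta> = 0"
  proof (rule ccontr)
    assume "\<delta> \<noteq> 0"
    have "\<beta> > 0"
    proof (rule ccontr)
      assume "\<not> \<beta> > 0"
      then have "(\<delta>, 0) \<in> ineq_lineality A K B"
        using \<beta> by auto
      then show False
        using sep \<delta>(1) \<open>\<delta> \<noteq> 0\<close> by (force simp: in_ineq_lineality_iff)
    qed
    define l where "l = (\<delta>, 0) - \<beta> *\<^sub>R v"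
    have "v = (1 / \<beta>) *\<^sub>R (\<delta>, 0) + (- (1 / \<beta>)) *\<^sub>R l"
      unfolding l_def using \<open>\<beta> > 0\<close>
      by (simp add: algebra_simps del: scaleR_Pair)
    moreover have "(- (1 / \<beta>)) *\<^sub>R l \<in> ineq_lineality A K B"
      unfolding l_def using SL \<beta>(2) by (rule subspace_scale)
    ultimately have "L_multiple (ineq_lineality A K B) v (\<delta>, 0)"
      unfolding L_multiple_def using \<open>\<beta> > 0\<close> by (intro exI[of _ "1 / \<beta>"] conjI bexI) auto
    then show False
      using vGC(2) \<delta>(1) \<open>\<delta> \<noteq> 0\<close> unfolding cone_implied_mod_L_def by blast
  qed
qed (fact v(2))

lemma minimal_ineqs_generated:
  assumes gs: "generating_set A K B GL GC"
  shows "minimal_ineqs A K B \<subseteq> generated_by GL (non_cone_implied_part A K B GC)"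
proof
  fix m assume m: "m \<in> minimal_ineqs A K B"
  let ?L = "ineq_lineality A K B" and ?N = "non_cone_implied_part A K B GC"
  note L = generating_set_span_lineality[OF gs]
  note SL = subspace_lineality[OF convex_cone_valid_ineqs, of A K B]
  have "m \<in> generated_by GL GC"
    using m unfolding generating_set_generates[OF gs] by (simp add: minimal_ineqs_iff)
  then obtain a b where ab: "m = a + b" "a \<in> span GL" "b \<in> convex_cone hull GC"
    by (rule generated_byE)
  have "b \<in> convex_cone hull ((GC - ?N) \<union> ?N)"
    using ab(3) by (simp add: non_cone_implied_part_def Un_absorb2)
  then obtain p n where pn: "b = p + n" "p \<in> convex_cone hull (GC - ?N)" "n \<in> convex_cone hull ?N"
    unfolding convex_cone_hull_Un by blast
  \<comment> \<open>The cone-implied inequalities together with \<open>L\<close> span a convex cone, and it contains all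
      generators outside \<open>?N\<close>.\<close>
  have "convex_cone hull (GC - ?N) \<subseteq> (\<Union>x\<in>dual_cone K \<times> {0}. \<Union>y\<in>?L. {x + y})"
  proof (rule hull_minimal)
    show "convex_cone (\<Union>x\<in>dual_cone K \<times> {0}. \<Union>y\<in>?L. {x + y})"
      by (intro convex_cone_sums convex_cone_Times convex_cone_dual_cone convex_cone_singleton
          subspace_imp_convex_cone SL)
    show "GC - ?N \<subseteq> (\<Union>x\<in>dual_cone K \<times> {0}. \<Union>y\<in>?L. {x + y})"
    proof
      fix v assume "v \<in> GC - ?N"
      then obtain \<delta> \<tau> l where "\<delta> \<in> dual_cone K" "\<tau> > 0" "l \<in> ?L" "v = \<tau> *\<^sub>R (\<delta>, 0) + l"
        by (auto simp: non_cone_implied_part_def cone_implied_mod_L_def L_multiple_def)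
      moreover from this have "\<tau> *\<^sub>R \<delta> \<in> dual_cone K"
        by (intro convex_cone_scaleR[OF convex_cone_dual_cone]) auto
      ultimately show "v \<in> (\<Union>x\<in>dual_cone K \<times> {0}. \<Union>y\<in>?L. {x + y})"
        by (intro UN_I[of "(\<tau> *\<^sub>R \<delta>, 0)"] UN_I[of l]) auto
    qed
  qed
  with pn(2) obtain \<delta> l where \<delta>: "\<delta> \<in> dual_cone K" "l \<in> ?L" "p = (\<delta>, 0) + l"
    by blast
  have al: "a + l \<in> ?L"
    using ab(2) \<delta>(2) unfolding L by (intro subspace_add[OF SL])
  have "?N \<subseteq> valid_ineqs A K B"
    using generating_set_subset_valid[OF gs] by (auto simp: non_cone_implied_part_def)
  then have "n \<in> valid_ineqs A K B"
    using pn(3) hull_minimal[of ?N _ convex_cone] convex_cone_valid_ineqs by blast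
  then have "n + (a + l) \<in> valid_ineqs A K B"
    using al by (rule add_lineality_imp_in_cone[OF convex_cone_valid_ineqs])
  moreover have "m - (\<delta>, 0) = n + (a + l)"
    unfolding ab(1) pn(1) \<delta>(3) by (simp add: algebra_simps)
  ultimately have "\<delta> = 0"
    using m \<delta>(1) unfolding minimal_ineqs_iff by metis
  then have "m = (a + l) + n"
    unfolding ab(1) pn(1) \<delta>(3) by (simp add: algebra_simps zero_prod_def[symmetric])
  then show "m \<in> generated_by GL ?N"
    using al pn(3) L by (auto intro!: span_plus_hull_in_generated_by)
qed

section \<open>The closed convex hull\<close>

text \<open>
  Moving from a feasible point \<open>y\<close> through a relatively interior point \<open>z\<close> one stays in the convex hull
  for a while, so \<open>\<delta> \<bullet> z = 0\<close> together with nonnegativity of \<open>\<delta>\<close> on the hull forces \<open>\<delta> \<bullet> y \<le> 0\<close>.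
\<close>

lemma ex_hull_point_positive_on_dual_cone:
  fixes K S :: "'a::euclidean_space set"
  assumes "S \<noteq> {}" "S \<subseteq> K"
    and sep: "\<forall>\<delta>\<in>dual_cone K - {0}. \<exists>x\<in>S. \<delta> \<bullet> x > 0"
  obtains z where "z \<in> convex hull S" "\<And>\<delta>. \<delta> \<in> dual_cone K \<Longrightarrow> \<delta> \<noteq> 0 \<Longrightarrow> \<delta> \<bullet> z > 0"
proof -
  have "rel_interior (convex hull S) \<noteq> {}"
    using \<open>S \<noteq> {}\<close> by (simp add: rel_interior_eq_empty)
  then obtain z where z: "z \<in> rel_interior (convex hull S)"
    by blast
  have zS: "z \<in> convex hull S"
    using z rel_interior_subset by blast
  have "\<delta> \<bullet> z > 0" if \<delta>: "\<delta> \<in> dual_cone K" "\<delta> \<noteq> 0" for \<delta>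
  proof -
    have "convex hull S \<subseteq> {x. \<delta> \<bullet> x \<ge> 0}"
      using dual_cone_inner_nonneg[OF \<delta>(1)] \<open>S \<subseteq> K\<close>
      by (intro hull_minimal convex_halfspace_ge) auto
    then have nonneg: "\<delta> \<bullet> x \<ge> 0" if "x \<in> convex hull S" for x
      using that by blast
    obtain y where y: "y \<in> S" "\<delta> \<bullet> y > 0"
      using sep \<delta> by blast
    then have "y \<in> convex hull S"
      by (simp add: hull_inc)
    with z \<open>S \<noteq> {}\<close> obtain e where e: "e > 1" "(1 - e) *\<^sub>R y + e *\<^sub>R z \<in> convex hull S"
      using convex_rel_interior_iff[of "convex hull S" z] by auto
    have "0 \<le> (1 - e) * (\<delta> \<bullet> y) + e * (\<delta> \<bullet> z)"
      using nonneg[OF e(2)] by (simp add: inner_right_distrib)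
    moreover have "(1 - e) * (\<delta> \<bullet> y) < 0"
      using e(1) y(2) by (simp add: mult_neg_pos)
    ultimately have "e * (\<delta> \<bullet> z) > 0"
      by linarith
    with e(1) show ?thesis
      by (simp add: zero_less_mult_iff)
  qed
  with zS show ?thesis
    by (rule that)
qed

lemma closed_dual_cone: "closed (dual_cone K)"
proof -
  have "dual_cone K = (\<Inter>x\<in>K. {y. x \<bullet> y \<ge> 0})"
    by (auto simp: dual_cone_def)
  then show ?thesis
    by (auto intro!: closed_INT closed_halfspace_ge)
qed

text \<open>A functional positive on a closed cone minus the origin grows at least linearly on the cone.\<close>

lemma bounded_cone_section:
  fixes D :: "'a::euclidean_space set"
  assumes "closed D" "convex_cone D" and pos: "\<And>\<delta>. \<delta> \<in> D \<Longrightarrow> \<delta> \<noteq> 0 \<Longrightarrow> \<delta> \<bullet> z > 0"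
  shows "bounded {\<delta> \<in> D. \<delta> \<bullet> z \<le> c}"
proof -
  have "\<exists>\<epsilon>>0. \<forall>\<delta>\<in>D \<inter> sphere 0 1. \<epsilon> \<le> \<delta> \<bullet> z"
  proof (cases "D \<inter> sphere 0 1 = {}")
    case True
    then show ?thesis by (auto intro: exI[of _ 1])
  next
    case False
    have "compact (D \<inter> sphere 0 1)"
      using \<open>closed D\<close> by (simp add: closed_Int_compact)
    moreover have "continuous_on (D \<inter> sphere 0 1) (\<lambda>\<delta>. \<delta> \<bullet> z)"
      by (intro continuous_intros)
    ultimately obtain u where "u \<in> D \<inter> sphere 0 1" "\<forall>\<delta>\<in>D \<inter> sphere 0 1. u \<bullet> z \<le> \<delta> \<bullet> z"
      using continuous_attains_inf[of "D \<inter> sphere 0 1" "\<lambda>\<delta>. \<delta> \<bullet> z"] False by blast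
    moreover from this have "u \<bullet> z > 0"
      by (intro pos) auto
    ultimately show ?thesis
      by blast
  qed
  then obtain \<epsilon> where \<epsilon>: "\<epsilon> > 0" "\<And>\<delta>. \<delta> \<in> D \<inter> sphere 0 1 \<Longrightarrow> \<epsilon> \<le> \<delta> \<bullet> z"
    by blast
  have "norm \<delta> \<le> \<bar>c\<bar> / \<epsilon>" if \<delta>: "\<delta> \<in> D" "\<delta> \<bullet> z \<le> c" for \<delta>
  proof (cases "\<delta> = 0")
    case True
    then show ?thesis using \<epsilon>(1) by simp
  next
    case False
    have "(1 / norm \<delta>) *\<^sub>R \<delta> \<in> D \<inter> sphere 0 1"
      using False \<delta>(1) by (auto intro!: convex_cone_scaleR[OF assms(2)])
    from \<epsilon>(2)[OF this] have "\<epsilon> * norm \<delta> \<le> \<delta> \<bullet> z"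
      using False by (simp add: field_simps)
    with \<delta>(2) \<epsilon>(1) show ?thesis
      by (simp add: pos_le_divide_eq mult.commute)
  qed
  then show ?thesis
    unfolding bounded_iff by blast
qed

text \<open>
  Subtract from \<open>\<mu>\<close> as much of \<open>K\<^sup>*\<close> as validity permits, measured by \<open>\<delta> \<bullet> z\<close>. The maximum is
  attained because validity at \<open>z\<close> bounds \<open>\<delta> \<bullet> z\<close>, and no further element of \<open>K\<^sup>*\<close> can be
  subtracted because the functional is positive on \<open>K\<^sup>* - {0}\<close>. The point \<open>x\<close> of \<open>K\<close> that violates
  the inequality keeps the result nontrivial.
\<close>

lemma ex_minimal_ineq_dominating:
  fixes K :: "'a::euclidean_space set"
  assumes nonempty: "feasible_set A K B \<noteq> {}"
    and sep: "\<forall>\<delta>\<in>dual_cone K - {0}. \<exists>x\<in>feasible_set A K B. \<delta> \<bullet> x > 0"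
    and valid: "(\<mu>, \<eta>) \<in> valid_ineqs A K B"
    and x: "x \<in> K" "\<mu> \<bullet> x < \<eta>"
  obtains \<rho> where "(\<rho>, \<eta>) \<in> minimal_ineqs A K B" "\<mu> - \<rho> \<in> dual_cone K"
proof -
  let ?S = "feasible_set A K B"
  have "?S \<subseteq> K"
    by (auto simp: feasible_set_def)
  obtain z where z: "z \<in> convex hull ?S" "\<And>\<delta>. \<delta> \<in> dual_cone K \<Longrightarrow> \<delta> \<noteq> 0 \<Longrightarrow> \<delta> \<bullet> z > 0"
    using ex_hull_point_positive_on_dual_cone[OF nonempty \<open>?S \<subseteq> K\<close> sep] by blast
  define T where "T = {\<delta> \<in> dual_cone K. (\<mu> - \<delta>, \<eta>) \<in> valid_ineqs A K B}"
  have "T \<subseteq> {\<delta> \<in> dual_cone K. \<delta> \<bullet> z \<le> \<mu> \<bullet> z - \<eta>}"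
  proof
    fix \<delta> assume \<delta>: "\<delta> \<in> T"
    then have "convex hull ?S \<subseteq> {y. (\<mu> - \<delta>) \<bullet> y \<ge> \<eta>}"
      by (intro hull_minimal convex_halfspace_ge) (auto simp: T_def valid_ineqs_def)
    with z(1) \<delta> show "\<delta> \<in> {\<delta> \<in> dual_cone K. \<delta> \<bullet> z \<le> \<mu> \<bullet> z - \<eta>}"
      by (auto simp: T_def inner_diff_left)
  qed
  then have "bounded T"
    using bounded_cone_section[OF closed_dual_cone convex_cone_dual_cone z(2)]
    by (rule bounded_subset[rotated])
  moreover have "closed T"
  proof -
    have "T = dual_cone K \<inter> (\<Inter>y\<in>?S. {\<delta>. y \<bullet> \<delta> \<le> y \<bullet> \<mu> - \<eta>})"
      by (auto simp: T_def valid_ineqs_def inner_diff_left inner_commute algebra_simps)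
    then show ?thesis
      by (auto intro!: closed_Int closed_INT closed_halfspace_le closed_dual_cone)
  qed
  ultimately have "compact T"
    by (simp add: compact_eq_bounded_closed)
  moreover have "0 \<in> T"
    using valid convex_cone_contains_0[OF convex_cone_dual_cone] by (simp add: T_def)
  moreover have "continuous_on T (\<lambda>\<delta>. \<delta> \<bullet> z)"
    by (intro continuous_intros)
  ultimately obtain \<delta> where \<delta>: "\<delta> \<in> T" "\<And>\<delta>'. \<delta>' \<in> T \<Longrightarrow> \<delta>' \<bullet> z \<le> \<delta> \<bullet> z"
    using continuous_attains_sup[of T "\<lambda>\<delta>. \<delta> \<bullet> z"] by blast
  have "(\<mu> - \<delta>, \<eta>) \<in> minimal_ineqs A K B"
    unfolding minimal_ineqs_iff
  proof (intro conjI ballI impI)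
    show "(\<mu> - \<delta>, \<eta>) \<in> valid_ineqs A K B"
      using \<delta>(1) by (simp add: T_def)
    show "fst (\<mu> - \<delta>, \<eta>) \<noteq> 0"
    proof
      \<comment> \<open>The inequality \<open>0 \<ge> \<eta>\<close> would hold at the feasible points, but it is violated at \<open>x\<close>.\<close>
      assume "fst (\<mu> - \<delta>, \<eta>) = 0"
      then have "\<eta> \<le> 0" "\<mu> = \<delta>"
        using \<delta>(1) nonempty by (auto simp: T_def valid_ineqs_def)
      moreover have "0 \<le> \<delta> \<bullet> x"
        using \<delta>(1) x(1) dual_cone_inner_nonneg by (auto simp: T_def)
      ultimately show False
        using x(2) by simp
    qed
    fix \<epsilon> assume \<epsilon>: "\<epsilon> \<in> dual_cone K" "(\<mu> - \<delta>, \<eta>) - (\<epsilon>, 0) \<in> valid_ineqs A K B"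
    have "\<delta> + \<epsilon> \<in> T"
      using \<delta>(1) \<epsilon> convex_cone_add[OF convex_cone_dual_cone, of \<delta> K \<epsilon>]
      by (simp add: T_def algebra_simps)
    from \<delta>(2)[OF this] have "\<epsilon> \<bullet> z \<le> 0"
      by (simp add: inner_left_distrib)
    with z(2)[OF \<epsilon>(1)] show "\<epsilon> = 0"
      by fastforce
  qed
  moreover have "\<mu> - (\<mu> - \<delta>) \<in> dual_cone K"
    using \<delta>(1) by (simp add: T_def)
  ultimately show ?thesis
    by (rule that)
qed

lemma closed_hull_eq_minimal_ineqs:
  fixes K :: "'a::euclidean_space set"
  assumes K: "closed K" "convex K"
    and nonempty: "feasible_set A K B \<noteq> {}"
    and sep: "\<forall>\<delta>\<in>dual_cone K - {0}. \<exists>x\<in>feasible_set A K B. \<delta> \<bullet> x > 0"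
  shows "closure (convex hull (feasible_set A K B)) =
    {x. x \<in> K \<and> (\<forall>(\<mu>, \<eta>) \<in> minimal_ineqs A K B. \<mu> \<bullet> x \<ge> \<eta>)}" (is "?H = ?R")
proof
  have "?R = K \<inter> (\<Inter>p\<in>minimal_ineqs A K B. {x. fst p \<bullet> x \<ge> snd p})"
    by force
  then have "closed ?R" "convex ?R"
    using K by (auto intro!: closed_Int closed_INT closed_halfspace_ge convex_Int convex_INT
        convex_halfspace_ge)
  moreover have "feasible_set A K B \<subseteq> ?R"
    by (auto simp: minimal_ineqs_def valid_ineqs_def feasible_set_def)
  ultimately show "?H \<subseteq> ?R"
    by (intro closure_minimal hull_minimal)
next
  show "?R \<subseteq> ?H"
  proof (intro subsetI, rule ccontr)
    fix x assume x: "x \<in> ?R" "x \<notin> ?H"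
    have "convex ?H" "closed ?H"
      by (auto simp: convex_closure)
    then obtain \<mu> \<eta> where \<mu>: "\<mu> \<bullet> x < \<eta>" "\<forall>y\<in>?H. \<mu> \<bullet> y > \<eta>"
      using separating_hyperplane_closed_point[of ?H x] x(2) by blast
    have "feasible_set A K B \<subseteq> ?H"
      using hull_subset closure_subset by (rule order_trans)
    then have "(\<mu>, \<eta>) \<in> valid_ineqs A K B"
      using \<mu>(2) by (force simp: valid_ineqs_def)
    then obtain \<rho> where \<rho>: "(\<rho>, \<eta>) \<in> minimal_ineqs A K B" "\<mu> - \<rho> \<in> dual_cone K"
      using ex_minimal_ineq_dominating[OF nonempty sep] x(1) \<mu>(1) by blast
    then have "\<eta> \<le> \<rho> \<bullet> x" "0 \<le> (\<mu> - \<rho>) \<bullet> x"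
      using x(1) dual_cone_inner_nonneg by auto
    with \<mu>(1) show False
      by (simp add: inner_diff_left)
  qed
qed

section \<open>Minimal inequalities as generators\<close>

theorem corollary2p1:
  fixes A :: "'a::euclidean_space \<Rightarrow> real ^ 'm"
    and K :: "'a set"
    and B :: "(real ^ 'm) set"
  assumes "regular_cone K"
    and "linear A"
    and "B \<noteq> {}"
    and "feasible_set A K B \<noteq> {}"
    and "feasible_set A K B \<noteq> K"
    and "\<forall>\<delta>\<in>dual_cone K - {0}. \<exists>x\<in>feasible_set A K B. \<delta> \<bullet> x > 0"
  shows "(\<forall>GL GC. generating_set A K B GL GC \<longrightarrow>
            (\<forall>v \<in> GL \<union> non_cone_implied_part A K B GC. fst v \<noteq> 0 \<longrightarrow> v \<in> minimal_ineqs A K B) \<and>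
            minimal_ineqs A K B \<subseteq> generated_by GL (non_cone_implied_part A K B GC))
       \<and> (\<forall>\<mu> \<eta>\<^sub>0. extreme_ineq A K B (\<mu>, \<eta>\<^sub>0) \<and> \<mu> \<noteq> 0 \<and> \<not> cone_implied_mod_L A K B (\<mu>, \<eta>\<^sub>0)
            \<longrightarrow> (\<mu>, \<eta>\<^sub>0) \<in> minimal_ineqs A K B)
       \<and> closure (convex hull (feasible_set A K B)) =
            {x. x \<in> K \<and> (\<forall>(\<mu>, \<eta>\<^sub>0) \<in> minimal_ineqs A K B. \<mu> \<bullet> x \<ge> \<eta>\<^sub>0)}"
proof (intro conjI allI impI)
  fix GL GC assume gs: "generating_set A K B GL GC"
  show "\<forall>v \<in> GL \<union> non_cone_implied_part A K B GC. fst v \<noteq> 0 \<longrightarrow> v \<in> minimal_ineqs A K B"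
    using lineality_ineq_minimal[OF assms(6)] non_cone_implied_generator_minimal[OF assms(6) gs]
      span_superset[of GL] unfolding generating_set_span_lineality[OF gs] by blast
  show "minimal_ineqs A K B \<subseteq> generated_by GL (non_cone_implied_part A K B GC)"
    by (rule minimal_ineqs_generated[OF gs])
next
  fix \<mu> \<eta>\<^sub>0
  assume *: "extreme_ineq A K B (\<mu>, \<eta>\<^sub>0) \<and> \<mu> \<noteq> 0 \<and> \<not> cone_implied_mod_L A K B (\<mu>, \<eta>\<^sub>0)"
  then obtain GL GC where gs: "generating_set A K B GL GC" "(\<mu>, \<eta>\<^sub>0) \<in> GL \<union> GC"
    unfolding extreme_ineq_def by blast
  show "(\<mu>, \<eta>\<^sub>0) \<in> minimal_ineqs A K B"
  proof (cases "(\<mu>, \<eta>\<^sub>0) \<in> GL")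
    case True
    then have "(\<mu>, \<eta>\<^sub>0) \<in> ineq_lineality A K B"
      using span_superset[of GL] unfolding generating_set_span_lineality[OF gs(1)] by blast
    then show ?thesis
      using lineality_ineq_minimal[OF assms(6)] * by simp
  next
    case False
    then have "(\<mu>, \<eta>\<^sub>0) \<in> non_cone_implied_part A K B GC"
      using gs(2) * by (auto simp: non_cone_implied_part_def)
    then show ?thesis
      using non_cone_implied_generator_minimal[OF assms(6) gs(1)] * by simp
  qed
next
  have "closed K" "convex K"
    using assms(1) by (auto simp: regular_cone_def convex_cone_def)
  then show "closure (convex hull (feasible_set A K B)) =
      {x. x \<in> K \<and> (\<forall>(\<mu>, \<eta>\<^sub>0) \<in> minimal_ineqs A K B. \<mu> \<bullet> x \<ge> \<eta>\<^sub>0)}"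
    using assms(4,6) by (rule closed_hull_eq_minimal_ineqs)
qed

end
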